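(* Let $G:\mathbb{Z}_{>0}\to\mathbb{Z}_{>0}$ be defined by $$G(n)=\begin{cases}5n+1 & \text{if } n=h(n),\\ h(n) & \text{if } n>h(n),\end{cases}\qquad h(n)=2^{v_2(n)}\,3^{v_3(n)}.$$ Then for every positive integer $n$, the sequence $n, G(n), G(G(n)),\dots$ eventually reaches $1$.
   Context: $v_p(n)$ denotes the exponent of the prime $p$ in the factorization of $n$. Thus $h(n)$ is the largest divisor of $n$ whose only prime factors are $2$ and $3$; $G$ either multiplies by $5$ and adds $1$ (when $n$ has no prime factors other than $2,3$), or removes all prime factors other than $2$ and $3$. *)

theory Defs
  imports "HOL-Computational_Algebra.Primes"
begin

definition h :: "nat \<Rightarrow> nat" where
  "h n = 2 ^ multiplicity 2 n * 3 ^ multiplicity 3 n"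

text \<open>Positive integers are represented as those \<open>n :: nat\<close> with \<open>n > 0\<close>; the value at \<open>0\<close> is
  irrelevant.\<close>

definition G :: "nat \<Rightarrow> nat" where
  "G n = (if n = h n then 5 * n + 1 else h n)"

text \<open>On positive integers \<open>h n \<le> n\<close>, so the second branch of \<open>G\<close> is exactly the case \<open>n > h n\<close>,
  and \<open>G\<close> maps positive integers to positive integers.\<close>

lemma h_dvd: "h n dvd n"
proof -
  have "coprime (2::nat) 3" by (simp add: primes_coprime)
  then show ?thesis
    unfolding h_def by (intro divides_mult multiplicity_dvd) simp
qed

lemma h_le: "n > 0 \<Longrightarrow> h n \<le> n"
  using h_dvd by (simp add: dvd_imp_le)

lemma G_pos: "G n > 0"
  by (simp add: G_def h_def)

end

theory Submission
  imports Defs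
begin

text \<open>If \<open>n\<close> is even, then \<open>5 n + 1\<close> is odd, so its \<open>3\<close>-smooth part is a power of \<open>3\<close>;
  hence it suffices to treat powers of \<open>3\<close>. If \<open>b > 0\<close> is even, the trajectory of \<open>3 ^ b\<close> goes to
  \<open>2\<close> and then to \<open>1\<close>. If \<open>b\<close> is odd, it passes through some \<open>2 ^ c\<close> with \<open>c \<ge> 3\<close> and then some
  \<open>3 ^ d\<close>. Here \<open>d \<ge> b\<close> is impossible for \<open>b \<ge> 3\<close>: otherwise both \<open>2 ^ c\<close> and \<open>3 ^ b\<close>, hence also
  their product, would divide the smaller number \<open>5 * 3 ^ b + 5 * 2 ^ c + 1\<close>. So the exponent of
  \<open>3\<close> descends.\<close>

definition reaches_one :: "nat \<Rightarrow> bool" where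
  "reaches_one n \<longleftrightarrow> (\<exists>k. (G ^^ k) n = 1)"

lemma reaches_one_1: "reaches_one 1"
  unfolding reaches_one_def by (rule exI[of _ 0]) simp

lemma reaches_one_step: "reaches_one (G n) \<Longrightarrow> reaches_one n"
  unfolding reaches_one_def by (metis comp_apply funpow_Suc_right)

text \<open>Either \<open>n = h n\<close>, or the first step from \<open>n\<close> lands on
  \<open>h n\<close>; so only numbers \<open>2 ^ a * 3 ^ b\<close> need care.\<close>

lemma reaches_one_h: "reaches_one (h n) \<Longrightarrow> reaches_one n"
  by (cases "n = h n") (auto simp: G_def intro: reaches_one_step)

lemma h_smooth: "h (2 ^ a * 3 ^ b) = 2 ^ a * 3 ^ b"
  by (simp add: h_def prime_elem_multiplicity_mult_distrib multiplicity_distinct_prime_power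
      multiplicity_same_power)

text \<open>Merges two moves: multiply by 5 and add 1, then pass to the smooth part (no move at all
  if the result is already smooth).\<close>

lemma reaches_one_smooth:
  assumes "reaches_one (h (5 * (2 ^ a * 3 ^ b) + 1))"
  shows "reaches_one (2 ^ a * 3 ^ b)"
proof (rule reaches_one_step)
  show "reaches_one (G (2 ^ a * 3 ^ b))"
    using reaches_one_h[OF assms] by (simp add: G_def h_smooth)
qed

lemma h_odd: "odd n \<Longrightarrow> h n = 3 ^ multiplicity 3 n"
  by (simp add: h_def not_dvd_imp_multiplicity_0)

lemma h_not_dvd_3: "\<not> 3 dvd n \<Longrightarrow> h n = 2 ^ multiplicity 2 n"
  by (simp add: h_def not_dvd_imp_multiplicity_0)

lemma h_eq_1: "odd n \<Longrightarrow> \<not> 3 dvd n \<Longrightarrow> h n = 1"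
  by (simp add: h_def not_dvd_imp_multiplicity_0)

lemma not_3_dvd_Suc_5_mult: "3 dvd m \<Longrightarrow> \<not> 3 dvd 5 * m + (1::nat)"
  by presburger

lemma power_3_even_mod_8: "even b \<Longrightarrow> 3 ^ b mod 8 = (1::nat)"
proof (elim evenE)
  fix k assume "b = 2 * k"
  then have "(3::nat) ^ b mod 8 = (9 mod 8) ^ k mod 8"
    by (simp only: power_mult power_mod) simp
  then show ?thesis by simp
qed

lemma power_3_odd_mod_8: "odd b \<Longrightarrow> 3 ^ b mod 8 = (3::nat)"
proof (elim oddE)
  fix k assume "b = 2 * k + 1"
  then show ?thesis
    using power_3_even_mod_8[of "2 * k"] by (simp add: mod_mult_right_eq) presburger
qed

lemma reaches_one_2: "reaches_one 2"
  using reaches_one_smooth[of 1 0] reaches_one_1 by (simp add: h_eq_1)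

lemma reaches_one_power_3_even:
  assumes "even b"
  shows "reaches_one (3 ^ b)"
proof (cases "b = 0")
  case True
  then show ?thesis using reaches_one_1 by simp
next
  case False
  let ?m = "5 * 3 ^ b + 1 :: nat"
  have "\<not> 3 dvd ?m" using False by (intro not_3_dvd_Suc_5_mult) simp
  \<comment> \<open>\<open>3 ^ b\<close> is 1 mod 8, so \<open>?m\<close> is 6 mod 8: even, but not
    divisible by 4.\<close>
  moreover have "multiplicity 2 ?m = 1"
  proof (rule multiplicity_eqI)
    show "2 ^ 1 dvd ?m" by simp
    show "\<not> 2 ^ Suc 1 dvd ?m" using power_3_even_mod_8[OF assms] by simp presburger
  qed
  ultimately have "h ?m = 2" by (simp add: h_not_dvd_3)
  then show ?thesis using reaches_one_smooth[of 0 b] reaches_one_2 by simp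
qed

text \<open>The trajectory runs 3, 16, 81, and 81 is an even power of 3. The descent breaks down
  here: for \<open>b = 1\<close>, \<open>c = 4\<close> both divisibilities in
  \<open>not_mutual_dvd\<close> hold.\<close>

lemma reaches_one_3: "reaches_one 3"
proof -
  have "reaches_one 81"
    using reaches_one_power_3_even[of 4] by simp
  moreover have "h 81 = 81" "h 16 = 16"
    using h_smooth[of 0 4] h_smooth[of 4 0] by simp_all
  ultimately have "reaches_one 16"
    using reaches_one_smooth[of 4 0] by simp
  then show ?thesis
    using reaches_one_smooth[of 0 1] \<open>h 16 = 16\<close> by simp
qed

lemma not_mutual_dvd:
  fixes b c :: nat
  assumes "b \<ge> 3" "c \<ge> 3" "2 ^ c dvd 5 * 3 ^ b + (1::nat)"
  shows "\<not> 3 ^ b dvd 5 * 2 ^ c + (1::nat)"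
proof
  assume "3 ^ b dvd 5 * 2 ^ c + (1::nat)"
  then have "3 ^ b dvd 5 * 3 ^ b + (5 * 2 ^ c + (1::nat))"
    by (rule dvd_add[OF dvd_triv_right])
  moreover have "2 ^ c dvd 5 * 2 ^ c + (5 * 3 ^ b + (1::nat))"
    using assms(3) by (rule dvd_add[OF dvd_triv_right])
  then have "2 ^ c dvd 5 * 3 ^ b + (5 * 2 ^ c + (1::nat))" by (simp add: ac_simps)
  moreover have "coprime ((2::nat) ^ c) (3 ^ b)" by (simp add: primes_coprime)
  ultimately have "2 ^ c * 3 ^ b dvd 5 * 3 ^ b + (5 * 2 ^ c + (1::nat))"
    by (intro divides_mult)
  then have le: "2 ^ c * 3 ^ b \<le> 5 * 3 ^ b + (5 * 2 ^ c + (1::nat))"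
    by (rule dvd_imp_le) simp
  \<comment> \<open>Over the integers, \<open>le\<close> says that (2^c - 5)(3^b - 5) is at most 26,
    but the factors are at least 3 and 22.\<close>
  have "(2::nat) ^ c \<ge> 2 ^ 3" "(3::nat) ^ b \<ge> 3 ^ 3"
    using assms(1,2) by (auto intro!: power_increasing simp del: power_numeral)
  then obtain x y where "(2::nat) ^ c = 8 + x" "(3::nat) ^ b = 27 + y"
    by (auto simp: le_iff_add)
  with le show False by (simp add: algebra_simps)
qed

lemma reaches_one_power_3: "reaches_one (3 ^ b)"
proof (induction b rule: less_induct)
  case (less b)
  have "even b \<or> b = 1 \<or> (odd b \<and> b \<ge> 3)"
    by presburger
  then consider "even b" | "b = 1" | "odd b" "b \<ge> 3"
    by blast
  then show ?case
  proof cases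
    case 1
    then show ?thesis by (rule reaches_one_power_3_even)
  next
    case 2
    then show ?thesis using reaches_one_3 by simp
  next
    case 3
    define c where "c = multiplicity 2 (5 * 3 ^ b + 1 :: nat)"
    define d where "d = multiplicity 3 (5 * 2 ^ c + 1 :: nat)"
    have hc: "h (5 * 3 ^ b + 1) = 2 ^ c"
      unfolding c_def using 3 by (intro h_not_dvd_3 not_3_dvd_Suc_5_mult) simp
    \<comment> \<open>\<open>3 ^ b\<close> is 3 mod 8, and 5 * 3 + 1 = 16 vanishes mod 8.\<close>
    have "2 ^ 3 dvd 5 * 3 ^ b + (1::nat)"
      using power_3_odd_mod_8[OF 3(1)] by simp presburger
    then have c: "c \<ge> 3"
      unfolding c_def by (intro multiplicity_geI) auto
    have hd: "h (5 * 2 ^ c + 1) = 3 ^ d"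
      unfolding d_def using c by (intro h_odd) simp
    have "\<not> 3 ^ b dvd 5 * 2 ^ c + (1::nat)"
      using 3(2) c by (rule not_mutual_dvd) (simp add: c_def multiplicity_dvd)
    \<comment> \<open>If \<open>b\<close> were at most \<open>d\<close>, then \<open>3 ^ b\<close>
      would divide \<open>3 ^ d\<close> and hence \<open>5 * 2 ^ c + 1\<close>.\<close>
    then have "d < b"
      unfolding d_def by (meson multiplicity_dvd' not_le_imp_less)
    then have "reaches_one (2 ^ c)"
      using less.IH reaches_one_smooth[of c 0] hd by simp
    then show ?thesis
      using reaches_one_smooth[of 0 b] hc by simp
  qed
qed

lemma reaches_one_2_3_smooth: "reaches_one (2 ^ a * 3 ^ b)"
proof (cases "a = 0")
  case True
  then show ?thesis by (simp add: reaches_one_power_3)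
next
  case False
  then have "odd (5 * (2 ^ a * 3 ^ b) + 1 :: nat)" by simp
  then show ?thesis
    using reaches_one_smooth reaches_one_power_3 h_odd by metis
qed

theorem theorem4p6:
  fixes n :: nat
  assumes "n > 0"
  shows "\<exists>k::nat. (G ^^ k) n = 1"
proof -
  have "reaches_one (h n)"
    unfolding h_def by (rule reaches_one_2_3_smooth)
  then show ?thesis
    using reaches_one_h reaches_one_def by blast
qed

end
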